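(* There exist universal constants $0<c\le C<\infty$ such that, for every integer $T\ge1$, every $\{r_t\}_{t=1}^T\subset[0,1]$ and all $\varrho,\sigma>0$, in the Markovian regression model described in the context, $$c\,\Phi_T(\varrho,\sigma)\;\le\;\inf_{\hat\theta}\ \sup_{|\theta^\star|\le\varrho}\mathbf{E}\big[(\hat\theta-\theta^\star)^2\big]\;\le\;C\,\Phi_T(\varrho,\sigma),\qquad \Phi_T(\varrho,\sigma)=\mathbf{E}\Big[\Big(\frac{1}{\varrho^2}+\frac{z^{\mathsf T}Mz}{\sigma^2}\Big)^{-1}\Big],$$ where the expectation defining $\Phi_T$ is over $z\sim\mathsf{N}(0,I_T)$.
   Context: Covariates: $x_0=0$ and $x_t=\sqrt{r_t}\,x_{t-1}+\sqrt{1-r_t}\,z_t$ for $t=1,\dots,T$, with $z_1,\dots,z_T$ independent standard Gaussians. Responses: $y_t=x_t\theta^\star+\sigma w_t$, $t=1,\dots,T$, with $\theta^\star\in\mathbf{R}$ and $w_1,\dots,w_T$ i.i.d. standard Gaussian, independent of the covariates. The infimum is over measurable real-valued functions $\hat\theta$ of the data $\{(x_t,y_t)\}_{t=1}^T$. The matrix $M\in\mathbf{R}^{T\times T}$ has entries $$M_{ss'}=\sum_{t=\max(s,s')}^T\sqrt{c_{st}c_{s't}},\qquad c_{st}=(1-r_s)\prod_{\tau=s+1}^t r_\tau$$ (empty products equal $1$). *)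

theory Defs
  imports "HOL-Probability.Probability"
begin

text \<open>
  Families indexed by \<open>1, \<dots>, T\<close> are functions on \<^typ>\<open>nat\<close> of which only the values on
  \<open>{1..T}\<close> matter. The law \<open>N(0, I\<^sub>T)\<close> is the \<open>T\<close>-fold product of the standard normal law.
\<close>

definition gaussian_vec :: "nat \<Rightarrow> (nat \<Rightarrow> real) measure" where
  "gaussian_vec T = (\<Pi>\<^sub>M t\<in>{1..T}. std_normal_distribution)"

primrec covariate :: "(nat \<Rightarrow> real) \<Rightarrow> (nat \<Rightarrow> real) \<Rightarrow> nat \<Rightarrow> real" where
  "covariate r z 0 = 0"
| "covariate r z (Suc t) = sqrt (r (Suc t)) * covariate r z t + sqrt (1 - r (Suc t)) * z (Suc t)"

definition response :: "(nat \<Rightarrow> real) \<Rightarrow> real \<Rightarrow> real \<Rightarrow> (nat \<Rightarrow> real) \<Rightarrow> (nat \<Rightarrow> real) \<Rightarrow> nat \<Rightarrow> real" where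
  "response r \<sigma> \<theta> z w t = covariate r z t * \<theta> + \<sigma> * w t"

definition sample_space :: "nat \<Rightarrow> (nat \<Rightarrow> real \<times> real) measure" where
  "sample_space T = (\<Pi>\<^sub>M t\<in>{1..T}. borel \<Otimes>\<^sub>M borel)"

definition sample ::
  "nat \<Rightarrow> (nat \<Rightarrow> real) \<Rightarrow> real \<Rightarrow> real \<Rightarrow> (nat \<Rightarrow> real) \<times> (nat \<Rightarrow> real) \<Rightarrow> nat \<Rightarrow> real \<times> real" where
  "sample T r \<sigma> \<theta> = (\<lambda>(z, w). \<lambda>t\<in>{1..T}. (covariate r z t, response r \<sigma> \<theta> z w t))"

text \<open>
  The mean squared error of an arbitrary estimator may be infinite, so it is a nonnegative integral
  with values in \<^typ>\<open>ennreal\<close>. The product measure expresses the independence of \<open>z\<close> and \<open>w\<close>.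
\<close>

definition mean_squared_error ::
  "nat \<Rightarrow> (nat \<Rightarrow> real) \<Rightarrow> real \<Rightarrow> ((nat \<Rightarrow> real \<times> real) \<Rightarrow> real) \<Rightarrow> real \<Rightarrow> ennreal" where
  "mean_squared_error T r \<sigma> \<delta> \<theta> =
     (\<integral>\<^sup>+ \<omega>. ennreal ((\<delta> (sample T r \<sigma> \<theta> \<omega>) - \<theta>)\<^sup>2) \<partial>(gaussian_vec T \<Otimes>\<^sub>M gaussian_vec T))"

definition minimax_risk :: "nat \<Rightarrow> (nat \<Rightarrow> real) \<Rightarrow> real \<Rightarrow> real \<Rightarrow> ennreal" where
  "minimax_risk T r \<rho> \<sigma> =
     (INF \<delta>\<in>borel_measurable (sample_space T).
        SUP \<theta>\<in>{\<theta>. \<bar>\<theta>\<bar> \<le> \<rho>}. mean_squared_error T r \<sigma> \<delta> \<theta>)"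

definition cov_coeff :: "(nat \<Rightarrow> real) \<Rightarrow> nat \<Rightarrow> nat \<Rightarrow> real" where
  "cov_coeff r s t = (1 - r s) * (\<Prod>\<tau>=s+1..t. r \<tau>)"

definition cov_matrix :: "nat \<Rightarrow> (nat \<Rightarrow> real) \<Rightarrow> nat \<Rightarrow> nat \<Rightarrow> real" where
  "cov_matrix T r s s' = (\<Sum>t=max s s'..T. sqrt (cov_coeff r s t * cov_coeff r s' t))"

definition quad_form :: "nat \<Rightarrow> (nat \<Rightarrow> nat \<Rightarrow> real) \<Rightarrow> (nat \<Rightarrow> real) \<Rightarrow> real" where
  "quad_form T M z = (\<Sum>s=1..T. \<Sum>s'=1..T. z s * M s s' * z s')"

text \<open>
  For \<open>r\<close> with values in \<open>[0, 1]\<close> the matrix is positive semidefinite, so the integrand lies in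
  \<open>(0, \<rho>\<^sup>2]\<close> and the integral below is a genuine, finite expectation.
\<close>

definition Phi :: "nat \<Rightarrow> (nat \<Rightarrow> real) \<Rightarrow> real \<Rightarrow> real \<Rightarrow> real" where
  "Phi T r \<rho> \<sigma> =
     (\<integral>z. inverse (1 / \<rho>\<^sup>2 + quad_form T (cov_matrix T r) z / \<sigma>\<^sup>2) \<partial>(gaussian_vec T))"

end

theory Submission
  imports Defs
begin

text \<open>
  Unrolling the recursion gives $x_t = \sum_{s \le t} \sqrt{c_{st}}\, z_s$, so $z^T M z$ is nothing
  but the energy $S = \sum_t x_t^2$ of the design. Conditionally on the covariates the experiment is
  a Gaussian linear regression with information $S / \sigma^2$, and
  $V = (1/\rho^2 + S/\sigma^2)^{-1}$ is the posterior variance of $\theta$ under the prior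
  $N(0, \rho^2)$. Thus $\Phi_T$ is the mean of $V$ over the design, and both inequalities come down
  to a comparison with $V$ for each fixed design.

  Upper bound, with constant 1 (\<open>minimax_risk_le_Phi\<close>): the ridge estimator
  $\sum_t x_t y_t / (S + \sigma^2/\rho^2)$ is the posterior mean for that prior. For every
  $|\theta| \le \rho$ its risk given the design is at most $V$, with equality at
  $|\theta| = \rho$ (\<open>ridge_conditional_risk\<close>).

  Lower bound, with constant $1/(16e)$ (\<open>Phi_le_sup_risk\<close>): a two-point argument needs the
  separation $h = \sqrt V$, which depends on the design, whereas the supremum over $\theta$ is taken
  outside the expectation. The uniform prior on $[-\rho, \rho]$ resolves this. The supremum dominates
  the average over $\theta$, Tonelli's theorem lets the design be fixed, and for a fixed design the
  average can be split into pairs $\theta, \theta + h$ with its own $h$. This is possible because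
  $h \le \rho$ (\<open>nn_integral_pairing_lower_bound\<close>). Passing from $\theta$ to $\theta + h$
  translates the standardised noise by the vector $x h / \sigma$, whose squared length
  $S V / \sigma^2$ is at most 1. The Cameron-Martin formula (\<open>nn_integral_gaussian_shift\<close>) turns the
  translation into a likelihood ratio that is not small on average, so the two squared errors sum to
  at least a constant times $h^2 = V$ (\<open>two_point_gaussian_lower_bound\<close>).
\<close>

section \<open>Gaussian integrals over finite products\<close>

interpretation std_normal: prob_space std_normal_distribution
  using prob_space_normal_density[of 1 0] by simp

interpretation std_normal_product: product_sigma_finite "\<lambda>_. std_normal_distribution"
  by unfold_locales

abbreviation gaussian_on :: "'i set \<Rightarrow> ('i \<Rightarrow> real) measure" where
  "gaussian_on I \<equiv> \<Pi>\<^sub>M i\<in>I. std_normal_distribution"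

lemma prob_space_gaussian_on: "prob_space (gaussian_on I)"
  by (intro prob_space_PiM std_normal.prob_space_axioms)

lemma sets_gaussian_on [measurable_cong]:
  "sets (gaussian_on I) = sets (\<Pi>\<^sub>M i\<in>I. borel)"
  by (intro sets_PiM_cong) auto

lemma nn_integral_std_normal_affine_square:
  "(\<integral>\<^sup>+y. ennreal ((\<alpha> + b * y)\<^sup>2) \<partial>std_normal_distribution) = ennreal (\<alpha>\<^sup>2 + b\<^sup>2)"
proof -
  have expand: "(\<alpha> + b * y)\<^sup>2 = \<alpha>\<^sup>2 + (2 * \<alpha> * b) * y + b\<^sup>2 * y\<^sup>2" for y
    by (simp add: power2_sum power_mult_distrib)
  have "has_bochner_integral std_normal_distribution (\<lambda>y::real. 1::real) 1"
    using std_normal.prob_space by (simp add: has_bochner_integral_iff)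
  moreover have "has_bochner_integral std_normal_distribution (\<lambda>y::real. y) 0"
    using integrable_std_normal_distribution_moment[of 1]
      integral_std_normal_distribution_moment_odd[of 1]
    by (simp add: has_bochner_integral_iff)
  moreover have "has_bochner_integral std_normal_distribution (\<lambda>y::real. y\<^sup>2) 1"
    using integrable_std_normal_distribution_moment[of 2] std_normal_distribution_even_moments(1)[of 1]
    by (simp add: has_bochner_integral_iff)
  ultimately have "has_bochner_integral std_normal_distribution
      (\<lambda>y. \<alpha>\<^sup>2 * 1 + (2 * \<alpha> * b) * y + b\<^sup>2 * y\<^sup>2) (\<alpha>\<^sup>2 * 1 + (2 * \<alpha> * b) * 0 + b\<^sup>2 * 1)"
    by (intro has_bochner_integral_add has_bochner_integral_mult_right)
  then have "has_bochner_integral std_normal_distribution (\<lambda>y. (\<alpha> + b * y)\<^sup>2) (\<alpha>\<^sup>2 + b\<^sup>2)"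
    by (simp only: expand mult_1_right mult_zero_right add_0_right)
  then show ?thesis
    by (subst nn_integral_eq_integral) (simp_all add: has_bochner_integral_iff)
qed

text \<open>
  Coordinates are independent, centred and of unit variance, so integrating them out one at a time
  leaves the squared constant plus the squared length of the coefficient vector. The nonnegative
  integral makes integrability a conclusion.
\<close>
lemma nn_integral_gaussian_affine_square:
  assumes "finite I"
  shows "(\<integral>\<^sup>+w. ennreal ((\<alpha> + (\<Sum>i\<in>I. b i * w i))\<^sup>2) \<partial>gaussian_on I)
      = ennreal (\<alpha>\<^sup>2 + (\<Sum>i\<in>I. (b i)\<^sup>2))"
  using assms
proof (induction I arbitrary: \<alpha>)
  case empty
  show ?case
    by (simp add: prob_space.emeasure_space_1[OF prob_space_gaussian_on])
next
  case (insert i I)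
  have upd: "(\<Sum>j\<in>insert i I. b j * (x(i := y)) j) = b i * y + (\<Sum>j\<in>I. b j * x j)" for x y
    using insert.hyps by (auto intro!: sum.cong)
  have "(\<integral>\<^sup>+w. ennreal ((\<alpha> + (\<Sum>j\<in>insert i I. b j * w j))\<^sup>2) \<partial>gaussian_on (insert i I))
     = (\<integral>\<^sup>+y. (\<integral>\<^sup>+x. ennreal ((\<alpha> + (\<Sum>j\<in>insert i I. b j * (x(i := y)) j))\<^sup>2) \<partial>gaussian_on I)
         \<partial>std_normal_distribution)"
    using insert.hyps by (intro std_normal_product.product_nn_integral_insert_rev) measurable
  also have "\<dots> = (\<integral>\<^sup>+y. (\<integral>\<^sup>+x. ennreal (((\<alpha> + b i * y) + (\<Sum>j\<in>I. b j * x j))\<^sup>2)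
        \<partial>gaussian_on I) \<partial>std_normal_distribution)"
    by (simp only: upd add.assoc)
  also have "\<dots> = (\<integral>\<^sup>+y. ennreal ((\<alpha> + b i * y)\<^sup>2) + ennreal (\<Sum>j\<in>I. (b j)\<^sup>2)
        \<partial>std_normal_distribution)"
    by (simp add: insert.IH sum_nonneg)
  also have "\<dots> = ennreal (\<alpha>\<^sup>2 + (b i)\<^sup>2) + ennreal (\<Sum>j\<in>I. (b j)\<^sup>2)"
    by (subst nn_integral_add)
       (use std_normal.emeasure_space_1 in \<open>auto simp: nn_integral_std_normal_affine_square\<close>)
  also have "\<dots> = ennreal (\<alpha>\<^sup>2 + (\<Sum>j\<in>insert i I. (b j)\<^sup>2))"
    using insert.hyps by (simp add: ennreal_plus[symmetric] sum_nonneg add.assoc del: ennreal_plus)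
  finally show ?case .
qed

text \<open>
  Translating the variable moves the density to $\varphi(y - a)$, and
  $\varphi(y - a) = \varphi(y)\, e^{a y - a^2/2}$.
\<close>
lemma nn_integral_std_normal_shift:
  assumes [measurable]: "f \<in> borel_measurable borel"
  shows "(\<integral>\<^sup>+y. f (y + a) \<partial>std_normal_distribution)
      = (\<integral>\<^sup>+y. f y * ennreal (exp (a * y - a\<^sup>2 / 2)) \<partial>std_normal_distribution)"
proof -
  have shift: "std_normal_density (x - a) = std_normal_density x * exp (a * x - a\<^sup>2 / 2)" for x
    by (simp add: std_normal_density_def exp_add[symmetric] power2_diff field_simps)
  have "(\<integral>\<^sup>+y. f (y + a) \<partial>std_normal_distribution)
      = (\<integral>\<^sup>+x. ennreal (std_normal_density ((a + x) - a)) * f (a + x) \<partial>lborel)"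
    by (simp add: nn_integral_density add.commute)
  also have "\<dots> = (\<integral>\<^sup>+x. ennreal (std_normal_density (x - a)) * f x \<partial>lborel)"
    using nn_integral_real_affine[of "\<lambda>x. ennreal (std_normal_density (x - a)) * f x" 1 a] by simp
  also have "\<dots> = (\<integral>\<^sup>+y. f y * ennreal (exp (a * y - a\<^sup>2 / 2)) \<partial>std_normal_distribution)"
    by (simp add: nn_integral_density shift ennreal_mult ac_simps)
  finally show ?thesis .
qed

text \<open>
  The Cameron-Martin formula in finite dimension: the one-dimensional formula applies to each
  coordinate in turn, and the density factors multiply.
\<close>
lemma nn_integral_gaussian_shift:
  assumes "finite I" and "F \<in> borel_measurable (gaussian_on I)"
  shows "(\<integral>\<^sup>+w. F (\<lambda>i\<in>I. w i + a i) \<partial>gaussian_on I)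
      = (\<integral>\<^sup>+w. F w * ennreal (exp (\<Sum>i\<in>I. a i * w i - (a i)\<^sup>2 / 2)) \<partial>gaussian_on I)"
  using assms
proof (induction I arbitrary: F)
  case empty
  show ?case
    by (intro nn_integral_cong) (auto simp: space_PiM)
next
  case (insert i I)
  note [measurable] = insert.prems
  \<comment> \<open>Likelihood ratios of the coordinates in \<open>J\<close> and of the new coordinate \<open>i\<close>.\<close>
  define L where "L = (\<lambda>J w. ennreal (exp (\<Sum>j\<in>J. a j * w j - (a j)\<^sup>2 / 2)))"
  define l where "l = (\<lambda>y. ennreal (exp (a i * y - (a i)\<^sup>2 / 2)))"
  have [measurable]: "L J \<in> borel_measurable (gaussian_on J)" for J
    unfolding L_def by measurable
  have [measurable]: "l \<in> borel_measurable borel"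
    unfolding l_def by measurable
  have F_upd: "(\<lambda>y. F (x(i := y))) \<in> borel_measurable borel" if "x \<in> space (gaussian_on I)" for x
    using measurable_compose[OF measurable_component_update[OF that insert.hyps(2)] insert.prems]
    by (simp add: fun_upd_def)
  have upd: "(\<lambda>j\<in>insert i I. (x(i := y)) j + a j) = (\<lambda>j\<in>I. x j + a j)(i := y + a i)" for x y
    using insert.hyps by (auto simp: fun_eq_iff)
  have L_upd: "L (insert i I) (x(i := y)) = l y * L I x" for x y
  proof -
    have "(\<Sum>j\<in>I. a j * (x(i := y)) j - (a j)\<^sup>2 / 2) = (\<Sum>j\<in>I. a j * x j - (a j)\<^sup>2 / 2)"
      using insert.hyps by (intro sum.cong) auto
    then show ?thesis
      using insert.hyps by (simp add: L_def l_def exp_add ennreal_mult)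
  qed
  have shift_space: "(\<lambda>j\<in>I. x j + a j) \<in> space (gaussian_on I)" for x
    by (auto simp: space_PiM)
  have "(\<integral>\<^sup>+w. F (\<lambda>j\<in>insert i I. w j + a j) \<partial>gaussian_on (insert i I))
     = (\<integral>\<^sup>+x. (\<integral>\<^sup>+y. F (\<lambda>j\<in>insert i I. (x(i := y)) j + a j) \<partial>std_normal_distribution) \<partial>gaussian_on I)"
    using insert.hyps by (intro std_normal_product.product_nn_integral_insert) measurable
  also have "\<dots> = (\<integral>\<^sup>+x. (\<integral>\<^sup>+y. F ((\<lambda>j\<in>I. x j + a j)(i := y)) * l y \<partial>std_normal_distribution) \<partial>gaussian_on I)"
    unfolding upd l_def
    by (intro nn_integral_cong nn_integral_std_normal_shift F_upd shift_space)
  also have "\<dots> = (\<integral>\<^sup>+x. (\<integral>\<^sup>+y. F (x(i := y)) * l y \<partial>std_normal_distribution) * L I x \<partial>gaussian_on I)"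
    unfolding L_def by (rule insert.IH) measurable
  also have "\<dots> = (\<integral>\<^sup>+x. (\<integral>\<^sup>+y. F (x(i := y)) * L (insert i I) (x(i := y)) \<partial>std_normal_distribution) \<partial>gaussian_on I)"
  proof (intro nn_integral_cong)
    fix x assume "x \<in> space (gaussian_on I)"
    note [measurable] = F_upd[OF this]
    show "(\<integral>\<^sup>+y. F (x(i := y)) * l y \<partial>std_normal_distribution) * L I x
        = (\<integral>\<^sup>+y. F (x(i := y)) * L (insert i I) (x(i := y)) \<partial>std_normal_distribution)"
      by (subst nn_integral_multc[symmetric]) (auto simp: L_upd mult.assoc)
  qed
  also have "\<dots> = (\<integral>\<^sup>+w. F w * L (insert i I) w \<partial>gaussian_on (insert i I))"
    using insert.hyps by (intro std_normal_product.product_nn_integral_insert[symmetric]) measurable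
  finally show ?case
    unfolding L_def .
qed

section \<open>Two-point lower bounds\<close>

text \<open>
  The pointwise form of the two-point bound. Here $u$ is the error at $\theta$, $u - h$ the error at
  $\theta + h$, and $e^{t - q/2}$ the likelihood ratio. Both weights are at least
  $m = \min(1, e^{t - q/2})$, and the two errors cannot both be small because
  $u^2 + (u - h)^2 \ge h^2/2$. Bounding $m$ below by a multiple of $1 - t^2/2$ replaces the
  expectation of a minimum by a second moment. The term in $t^2$ stands on the right so that all
  summands are nonnegative.
\<close>
lemma squared_errors_lower_bound:
  fixes u h t q :: real
  assumes "0 \<le> q" "q \<le> 1"
  shows "exp (-1) * h\<^sup>2 / 2
       \<le> u\<^sup>2 + (u - h)\<^sup>2 * exp (t - q / 2) + exp (-1) * h\<^sup>2 / 4 * t\<^sup>2"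
proof -
  define m where "m = min 1 (exp (t - q / 2))"
  have "2 * \<bar>t\<bar> \<le> 1 + t\<^sup>2"
    using sum_squares_bound[of "\<bar>t\<bar>" 1] by simp
  then have "- 1 - t\<^sup>2 / 2 \<le> min 0 (t - q / 2)"
    using assms by (auto simp: min_def abs_if split: if_splits)
  then have "exp (- 1 - t\<^sup>2 / 2) \<le> m"
    by (auto simp: m_def min_def exp_le_cancel_iff split: if_splits intro: order_trans)
  moreover have "exp (-1) * (1 - t\<^sup>2 / 2) \<le> exp (- 1 - t\<^sup>2 / 2)"
  proof -
    have "exp (-1) * (1 - t\<^sup>2 / 2) \<le> exp (-1) * exp (- (t\<^sup>2 / 2))"
      using exp_ge_add_one_self[of "- (t\<^sup>2 / 2)"] by (intro mult_left_mono) auto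
    then show ?thesis by (simp add: exp_add[symmetric])
  qed
  ultimately have m: "exp (-1) * (1 - t\<^sup>2 / 2) \<le> m" by simp
  have "h\<^sup>2 \<le> 2 * (u\<^sup>2 + (u - h)\<^sup>2)"
    using zero_le_power2[of "2 * u - h"] by (simp add: power2_eq_square algebra_simps)
  then have "m * (h\<^sup>2 / 2) \<le> m * (u\<^sup>2 + (u - h)\<^sup>2)"
    by (intro mult_left_mono) (auto simp: m_def)
  also have "\<dots> \<le> u\<^sup>2 + (u - h)\<^sup>2 * exp (t - q / 2)"
  proof -
    have "m * u\<^sup>2 \<le> 1 * u\<^sup>2" "m * (u - h)\<^sup>2 \<le> exp (t - q / 2) * (u - h)\<^sup>2"
      by (intro mult_right_mono; simp add: m_def)+
    then show ?thesis by (simp add: algebra_simps)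
  qed
  finally have "m * (h\<^sup>2 / 2) \<le> u\<^sup>2 + (u - h)\<^sup>2 * exp (t - q / 2)" .
  moreover have "exp (-1) * (1 - t\<^sup>2 / 2) * (h\<^sup>2 / 2) \<le> m * (h\<^sup>2 / 2)"
    using m by (intro mult_right_mono) auto
  ultimately show ?thesis by (simp add: algebra_simps)
qed

text \<open>
  After the translation is moved into a likelihood ratio, the pointwise bound is integrated. Its
  remainder $k\, t^2$ has mean $k |a|^2 \le k$, which costs half of the main term $2 k$.
\<close>
lemma two_point_gaussian_lower_bound:
  fixes g :: "('i \<Rightarrow> real) \<Rightarrow> real" and \<theta> h :: real
  assumes I: "finite I" and a: "(\<Sum>i\<in>I. (a i)\<^sup>2) \<le> 1"
    and g: "g \<in> borel_measurable (gaussian_on I)"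
  shows "ennreal (exp (-1) * h\<^sup>2 / 4)
      \<le> (\<integral>\<^sup>+w. ennreal ((g w - \<theta>)\<^sup>2) \<partial>gaussian_on I)
        + (\<integral>\<^sup>+w. ennreal ((g (\<lambda>i\<in>I. w i + a i) - (\<theta> + h))\<^sup>2) \<partial>gaussian_on I)"
proof -
  interpret G: prob_space "gaussian_on I" by (rule prob_space_gaussian_on)
  define q where "q = (\<Sum>i\<in>I. (a i)\<^sup>2)"
  define t where "t w = (\<Sum>i\<in>I. a i * w i)" for w
  define k where "k = exp (-1) * h\<^sup>2 / 4"
  have q: "0 \<le> q" "q \<le> 1" using a by (auto simp: q_def sum_nonneg)
  have k: "0 \<le> k" by (simp add: k_def)
  have [measurable]: "t \<in> borel_measurable (gaussian_on I)" unfolding t_def by measurable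
  note [measurable] = g
  define X where "X = (\<integral>\<^sup>+w. ennreal ((g w - \<theta>)\<^sup>2) \<partial>gaussian_on I)
        + (\<integral>\<^sup>+w. ennreal ((g (\<lambda>i\<in>I. w i + a i) - (\<theta> + h))\<^sup>2) \<partial>gaussian_on I)"
  have meas: "(\<lambda>w. ennreal ((g w - (\<theta> + h))\<^sup>2)) \<in> borel_measurable (gaussian_on I)"
    by (rule measurable_compose[OF g]) measurable
  have "(\<integral>\<^sup>+w. ennreal ((g (\<lambda>i\<in>I. w i + a i) - (\<theta> + h))\<^sup>2) \<partial>gaussian_on I)
      = (\<integral>\<^sup>+w. ennreal ((g w - (\<theta> + h))\<^sup>2)
            * ennreal (exp (\<Sum>i\<in>I. a i * w i - (a i)\<^sup>2 / 2)) \<partial>gaussian_on I)"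
    by (rule nn_integral_gaussian_shift[OF I meas])
  also have "\<dots> = (\<integral>\<^sup>+w. ennreal ((g w - \<theta> - h)\<^sup>2 * exp (t w - q / 2)) \<partial>gaussian_on I)"
  proof -
    have "(\<Sum>i\<in>I. a i * w i - (a i)\<^sup>2 / 2) = t w - q / 2" for w
      by (simp only: sum_subtractf sum_divide_distrib t_def q_def)
    then show ?thesis
      by (simp only: ennreal_mult'' exp_ge_zero diff_diff_eq)
  qed
  finally have X: "X = (\<integral>\<^sup>+w. ennreal ((g w - \<theta>)\<^sup>2) + ennreal ((g w - \<theta> - h)\<^sup>2 * exp (t w - q / 2))
       \<partial>gaussian_on I)"
    unfolding X_def by (subst nn_integral_add) auto
  have "ennreal (2 * k) = (\<integral>\<^sup>+w. ennreal (2 * k) \<partial>gaussian_on I)"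
    using G.emeasure_space_1 by simp
  also have "\<dots> \<le> (\<integral>\<^sup>+w. (ennreal ((g w - \<theta>)\<^sup>2) + ennreal ((g w - \<theta> - h)\<^sup>2 * exp (t w - q / 2)))
          + ennreal k * ennreal ((t w)\<^sup>2) \<partial>gaussian_on I)"
  proof (intro nn_integral_mono)
    fix w
    have "2 * k \<le> (g w - \<theta>)\<^sup>2 + (g w - \<theta> - h)\<^sup>2 * exp (t w - q / 2) + k * (t w)\<^sup>2"
      using squared_errors_lower_bound[OF q, of h "g w - \<theta>" "t w"] by (simp add: k_def)
    from ennreal_leI[OF this]
    show "ennreal (2 * k) \<le> (ennreal ((g w - \<theta>)\<^sup>2) + ennreal ((g w - \<theta> - h)\<^sup>2 * exp (t w - q / 2)))
          + ennreal k * ennreal ((t w)\<^sup>2)"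
      using k by (simp add: ennreal_mult)
  qed
  also have "\<dots> = X + ennreal k * (\<integral>\<^sup>+w. ennreal ((t w)\<^sup>2) \<partial>gaussian_on I)"
    unfolding X by (simp add: nn_integral_add nn_integral_cmult)
  also have "(\<integral>\<^sup>+w. ennreal ((t w)\<^sup>2) \<partial>gaussian_on I) = ennreal q"
    using nn_integral_gaussian_affine_square[OF I, of 0 a] by (simp add: t_def q_def)
  also have "X + ennreal k * ennreal q \<le> X + ennreal k"
    using k q by (intro add_left_mono) (simp add: ennreal_mult[symmetric] mult_left_le)
  finally have "ennreal k + ennreal k \<le> ennreal k + X"
    using k by (simp add: ennreal_plus[symmetric] add.commute del: ennreal_plus)
  then have "ennreal k \<le> X"
    by (simp add: ennreal_add_left_cancel_le)
  then show ?thesis by (simp add: X_def k_def)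
qed

text \<open>
  Both $\theta$ and $\theta + h$ lie in $[-\rho, \rho]$ as $\theta$ runs over $[-\rho, \rho - h]$,
  an interval of length $2\rho - h \ge \rho$. Integrating the pairwise bound over it counts no point
  of $[-\rho, \rho]$ more than twice.
\<close>
lemma nn_integral_pairing_lower_bound:
  fixes f :: "real \<Rightarrow> ennreal"
  assumes [measurable]: "f \<in> borel_measurable borel" and h: "0 \<le> h" "h \<le> \<rho>"
    and K: "0 \<le> K" "\<And>\<theta>. ennreal K \<le> f \<theta> + f (\<theta> + h)"
  shows "ennreal (\<rho> * K) \<le> 2 * (\<integral>\<^sup>+\<theta>\<in>{-\<rho>..\<rho>}. f \<theta> \<partial>lborel)"
proof -
  have "ennreal (\<rho> * K) \<le> ennreal K * ennreal (2 * \<rho> - h)"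
    using h K by (simp add: ennreal_mult[symmetric] mult.commute mult_left_mono)
  also have "\<dots> = (\<integral>\<^sup>+\<theta>\<in>{-\<rho>..\<rho>-h}. ennreal K \<partial>lborel)"
    using h by (subst nn_integral_cmult_indicator) auto
  also have "\<dots> \<le> (\<integral>\<^sup>+\<theta>. f \<theta> * indicator {-\<rho>..\<rho>-h} \<theta> + f (\<theta> + h) * indicator {-\<rho>..\<rho>-h} \<theta> \<partial>lborel)"
    using K by (intro nn_integral_mono) (auto split: split_indicator)
  also have "\<dots> = (\<integral>\<^sup>+\<theta>\<in>{-\<rho>..\<rho>-h}. f \<theta> \<partial>lborel) + (\<integral>\<^sup>+\<theta>. f (h + \<theta>) * indicator {h-\<rho>..\<rho>} (h + \<theta>) \<partial>lborel)"
    by (subst nn_integral_add)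
       (auto simp: add.commute intro!: arg_cong2[where f="(+)"] nn_integral_cong split: split_indicator)
  also have "(\<integral>\<^sup>+\<theta>. f (h + \<theta>) * indicator {h-\<rho>..\<rho>} (h + \<theta>) \<partial>lborel) = (\<integral>\<^sup>+\<theta>\<in>{h-\<rho>..\<rho>}. f \<theta> \<partial>lborel)"
    using nn_integral_real_affine[of "\<lambda>\<theta>. f \<theta> * indicator {h-\<rho>..\<rho>} \<theta>" 1 h] by simp
  also have "(\<integral>\<^sup>+\<theta>\<in>{-\<rho>..\<rho>-h}. f \<theta> \<partial>lborel) + (\<integral>\<^sup>+\<theta>\<in>{h-\<rho>..\<rho>}. f \<theta> \<partial>lborel)
      \<le> (\<integral>\<^sup>+\<theta>\<in>{-\<rho>..\<rho>}. f \<theta> \<partial>lborel) + (\<integral>\<^sup>+\<theta>\<in>{-\<rho>..\<rho>}. f \<theta> \<partial>lborel)"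
    using h by (intro add_mono nn_integral_mono) (auto split: split_indicator)
  finally show ?thesis by (simp add: mult_2)
qed

section \<open>The design\<close>

lemma covariate_eq_sum:
  "covariate r z t = (\<Sum>s=1..t. sqrt (cov_coeff r s t) * z s)"
proof (induction t)
  case (Suc t)
  have "cov_coeff r s (Suc t) = r (Suc t) * cov_coeff r s t" if "s \<in> {1..t}" for s
    using that by (simp add: cov_coeff_def)
  then have "(\<Sum>s=1..t. sqrt (cov_coeff r s (Suc t)) * z s)
      = sqrt (r (Suc t)) * (\<Sum>s=1..t. sqrt (cov_coeff r s t) * z s)"
    by (simp add: sum_distrib_left real_sqrt_mult mult.assoc)
  moreover have "cov_coeff r (Suc t) (Suc t) = 1 - r (Suc t)"
    by (simp add: cov_coeff_def)
  ultimately show ?case by (simp add: Suc.IH)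
qed simp

definition design_energy :: "nat \<Rightarrow> (nat \<Rightarrow> real) \<Rightarrow> (nat \<Rightarrow> real) \<Rightarrow> real" where
  "design_energy T r z = (\<Sum>t=1..T. (covariate r z t)\<^sup>2)"

text \<open>
  This is what the matrix is made for: its entries collect, over all times $t \ge \max(s, s')$, the
  products of the coefficients of $z_s$ and $z_{s'}$ in $x_t$.
\<close>
lemma quad_form_cov_matrix:
  "quad_form T (cov_matrix T r) z = design_energy T r z"
proof -
  define A where "A s t = sqrt (cov_coeff r s t) * z s" for s t
  \<comment> \<open>An indicator in place of the bounds on \<open>t\<close> makes the three summation ranges independent.\<close>
  have "quad_form T (cov_matrix T r) z
      = (\<Sum>s=1..T. \<Sum>s'=1..T. \<Sum>t=1..T. if max s s' \<le> t then A s t * A s' t else 0)"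
    unfolding quad_form_def
  proof (intro sum.cong refl)
    fix s s' assume s: "s \<in> {1..T}" "s' \<in> {1..T}"
    have "z s * cov_matrix T r s s' * z s' = (\<Sum>t=max s s'..T. A s t * A s' t)"
      by (simp add: cov_matrix_def A_def real_sqrt_mult sum_distrib_left sum_distrib_right ac_simps)
    also have "\<dots> = (\<Sum>t=1..T. if max s s' \<le> t then A s t * A s' t else 0)"
      using s by (intro sum.mono_neutral_cong_left) auto
    finally show "z s * cov_matrix T r s s' * z s' = \<dots>" .
  qed
  also have "\<dots> = (\<Sum>s=1..T. \<Sum>t=1..T. \<Sum>s'=1..T. if max s s' \<le> t then A s t * A s' t else 0)"
    by (intro sum.cong refl sum.swap)
  also have "\<dots> = (\<Sum>t=1..T. \<Sum>s=1..T. \<Sum>s'=1..T. if max s s' \<le> t then A s t * A s' t else 0)"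
    by (rule sum.swap)
  also have "\<dots> = (\<Sum>t=1..T. \<Sum>s=1..t. \<Sum>s'=1..t. A s t * A s' t)"
  proof (rule sum.cong[OF refl])
    fix t assume t: "t \<in> {1..T}"
    have "(\<Sum>s'=1..T. if max s s' \<le> t then A s t * A s' t else 0)
        = (if s \<le> t then \<Sum>s'=1..t. A s t * A s' t else 0)" for s
    proof (cases "s \<le> t")
      case True
      then show ?thesis
        using t by (simp, intro sum.mono_neutral_cong_right) auto
    qed simp
    then have "(\<Sum>s=1..T. \<Sum>s'=1..T. if max s s' \<le> t then A s t * A s' t else 0)
        = (\<Sum>s=1..T. if s \<le> t then \<Sum>s'=1..t. A s t * A s' t else 0)"
      by presburger
    also have "\<dots> = (\<Sum>s=1..t. \<Sum>s'=1..t. A s t * A s' t)"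
      using t by (intro sum.mono_neutral_cong_right) auto
    finally show "(\<Sum>s=1..T. \<Sum>s'=1..T. if max s s' \<le> t then A s t * A s' t else 0)
        = (\<Sum>s=1..t. \<Sum>s'=1..t. A s t * A s' t)" .
  qed
  also have "\<dots> = design_energy T r z"
    by (simp add: design_energy_def covariate_eq_sum A_def power2_eq_square sum_product)
  finally show ?thesis .
qed

lemma measurable_covariate:
  "t \<le> T \<Longrightarrow> (\<lambda>z. covariate r z t) \<in> borel_measurable (gaussian_on {1..T})"
  unfolding covariate_eq_sum by measurable

lemma measurable_design_energy [measurable]:
  "design_energy T r \<in> borel_measurable (gaussian_on {1..T})"
proof -
  have "(\<lambda>z. (\<Sum>t=1..T. (covariate r z t)\<^sup>2)) \<in> borel_measurable (gaussian_on {1..T})"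
    by (intro borel_measurable_sum borel_measurable_power measurable_covariate) auto
  then show ?thesis
    by (simp add: design_energy_def[abs_def])
qed

lemma design_energy_nonneg: "0 \<le> design_energy T r z"
  by (simp add: design_energy_def sum_nonneg)

text \<open>
  Measurability is joint in the parameter as well, so that the parameter can be averaged over a
  prior.
\<close>
lemma measurable_sample [measurable]:
  "(\<lambda>(\<theta>, \<omega>). sample T r \<sigma> \<theta> \<omega>)
    \<in> borel \<Otimes>\<^sub>M (gaussian_on {1..T} \<Otimes>\<^sub>M gaussian_on {1..T}) \<rightarrow>\<^sub>M sample_space T"
proof -
  let ?D = "borel \<Otimes>\<^sub>M (gaussian_on {1..T} \<Otimes>\<^sub>M gaussian_on {1..T})
    :: (real \<times> (nat \<Rightarrow> real) \<times> (nat \<Rightarrow> real)) measure"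
  have "(\<lambda>p. \<lambda>t\<in>{1..T}. (covariate r (fst (snd p)) t,
      covariate r (fst (snd p)) t * fst p + \<sigma> * snd (snd p) t)) \<in> ?D \<rightarrow>\<^sub>M sample_space T"
    unfolding sample_space_def
  proof (rule measurable_restrict)
    fix t assume t: "t \<in> {1..T}"
    then have "t \<le> T" by simp
    note [measurable] = measurable_covariate[OF this]
    show "(\<lambda>p. (covariate r (fst (snd p)) t,
        covariate r (fst (snd p)) t * fst p + \<sigma> * snd (snd p) t)) \<in> ?D \<rightarrow>\<^sub>M borel \<Otimes>\<^sub>M borel"
      using t by measurable
  qed
  then show ?thesis
    by (simp add: sample_def response_def case_prod_beta')
qed

text \<open>
  The posterior variance of $\theta$ under the prior $N(0, \rho^2)$, given a design of energy $S$
  and noise level $\sigma$.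
\<close>
definition posterior_variance :: "real \<Rightarrow> real \<Rightarrow> real \<Rightarrow> real" where
  "posterior_variance \<rho> \<sigma> S = inverse (1 / \<rho>\<^sup>2 + S / \<sigma>\<^sup>2)"

text \<open>
  With $h^2$ the posterior variance, the last two bounds say that $h$ is a separation that fits into
  $[-\rho, \rho]$ and translates the standardised noise by a vector of length at most 1.
\<close>
lemma posterior_variance_bounds:
  assumes "0 < \<rho>" "0 < \<sigma>" "0 \<le> S"
  shows "0 < posterior_variance \<rho> \<sigma> S"
    and "posterior_variance \<rho> \<sigma> S \<le> \<rho>\<^sup>2"
    and "S * posterior_variance \<rho> \<sigma> S \<le> \<sigma>\<^sup>2"
proof -
  have p: "0 < 1 / \<rho>\<^sup>2" "0 \<le> S / \<sigma>\<^sup>2" using assms by simp_all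
  show "0 < posterior_variance \<rho> \<sigma> S"
    using p by (simp add: posterior_variance_def add_pos_nonneg)
  have "posterior_variance \<rho> \<sigma> S \<le> inverse (1 / \<rho>\<^sup>2)"
    unfolding posterior_variance_def using p by (intro le_imp_inverse_le) auto
  then show "posterior_variance \<rho> \<sigma> S \<le> \<rho>\<^sup>2" by simp
  have "S / \<sigma>\<^sup>2 * posterior_variance \<rho> \<sigma> S
      \<le> (1 / \<rho>\<^sup>2 + S / \<sigma>\<^sup>2) * posterior_variance \<rho> \<sigma> S"
    using p \<open>0 < posterior_variance \<rho> \<sigma> S\<close> by (intro mult_right_mono) auto
  also have "\<dots> = 1"
    unfolding posterior_variance_def
    by (rule right_inverse) (use add_pos_nonneg[OF p] in simp)
  finally have "S / \<sigma>\<^sup>2 * posterior_variance \<rho> \<sigma> S \<le> 1" .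
  then show "S * posterior_variance \<rho> \<sigma> S \<le> \<sigma>\<^sup>2"
    using assms by (simp add: field_simps)
qed

lemma nn_integral_posterior_variance:
  assumes "0 < \<rho>" "0 < \<sigma>"
  shows "(\<integral>\<^sup>+z. ennreal (posterior_variance \<rho> \<sigma> (design_energy T r z)) \<partial>gaussian_on {1..T})
      = ennreal (Phi T r \<rho> \<sigma>)"
proof -
  interpret G: prob_space "gaussian_on {1..T}" by (rule prob_space_gaussian_on)
  note bounds = posterior_variance_bounds[OF assms design_energy_nonneg]
  have "(\<lambda>z. posterior_variance \<rho> \<sigma> (design_energy T r z)) \<in> borel_measurable (gaussian_on {1..T})"
    unfolding posterior_variance_def by measurable
  then have "integrable (gaussian_on {1..T}) (\<lambda>z. posterior_variance \<rho> \<sigma> (design_energy T r z))"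
    using bounds(1,2) by (intro G.integrable_const_bound[where B="\<rho>\<^sup>2"]) (auto simp: less_imp_le abs_of_pos)
  then show ?thesis
    using bounds(1)
    by (subst nn_integral_eq_integral)
       (auto simp: less_imp_le Phi_def gaussian_vec_def quad_form_cov_matrix posterior_variance_def)
qed

lemma mean_squared_error_iterated:
  assumes [measurable]: "\<delta> \<in> borel_measurable (sample_space T)"
  shows "mean_squared_error T r \<sigma> \<delta> \<theta>
    = (\<integral>\<^sup>+z. (\<integral>\<^sup>+w. ennreal ((\<delta> (sample T r \<sigma> \<theta> (z, w)) - \<theta>)\<^sup>2) \<partial>gaussian_on {1..T})
        \<partial>gaussian_on {1..T})"
proof -
  interpret G: prob_space "gaussian_on {1..T}" by (rule prob_space_gaussian_on)
  have "(\<lambda>\<omega>. sample T r \<sigma> \<theta> \<omega>) \<in> gaussian_on {1..T} \<Otimes>\<^sub>M gaussian_on {1..T} \<rightarrow>\<^sub>M sample_space T"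
    using measurable_compose[OF measurable_Pair1' measurable_sample, of \<theta>] by simp
  then have "(\<lambda>\<omega>. ennreal ((\<delta> (sample T r \<sigma> \<theta> \<omega>) - \<theta>)\<^sup>2))
      \<in> borel_measurable (gaussian_on {1..T} \<Otimes>\<^sub>M gaussian_on {1..T})"
    by measurable
  from G.nn_integral_fst[OF this] show ?thesis
    by (simp add: mean_squared_error_def gaussian_vec_def)
qed

section \<open>Upper bound by ridge regression\<close>

definition ridge_estimator :: "nat \<Rightarrow> real \<Rightarrow> (nat \<Rightarrow> real \<times> real) \<Rightarrow> real" where
  "ridge_estimator T \<mu> d =
     (\<Sum>t=1..T. fst (d t) * snd (d t)) / ((\<Sum>t=1..T. (fst (d t))\<^sup>2) + \<mu>)"

lemma measurable_ridge_estimator: "ridge_estimator T \<mu> \<in> borel_measurable (sample_space T)"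
  unfolding ridge_estimator_def[abs_def] sample_space_def by measurable

text \<open>
  With $\mu = \sigma^2/\rho^2$, the error has bias $-\mu\theta/(S + \mu)$ and variance
  $\sigma^2 S/(S + \mu)^2$. The penalty $\mu$ is chosen so that at $|\theta| = \rho$ the squared bias
  and the variance add up to $\sigma^2/(S + \mu)$, which is the posterior variance.
\<close>
lemma ridge_conditional_risk:
  assumes \<rho>: "0 < \<rho>" and \<sigma>: "0 < \<sigma>" and \<theta>: "\<bar>\<theta>\<bar> \<le> \<rho>"
  shows "(\<integral>\<^sup>+w. ennreal ((ridge_estimator T (\<sigma>\<^sup>2 / \<rho>\<^sup>2) (sample T r \<sigma> \<theta> (z, w)) - \<theta>)\<^sup>2)
      \<partial>gaussian_on {1..T}) \<le> ennreal (posterior_variance \<rho> \<sigma> (design_energy T r z))"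
proof -
  define S where "S = design_energy T r z"
  define \<mu> where "\<mu> = \<sigma>\<^sup>2 / \<rho>\<^sup>2"
  define x where "x t = covariate r z t" for t
  have pos: "0 \<le> S" "0 < \<mu>" "0 < S + \<mu>"
    using design_energy_nonneg[of T r z] \<rho> \<sigma> by (auto simp: S_def \<mu>_def intro: add_nonneg_pos)
  have error: "ridge_estimator T \<mu> (sample T r \<sigma> \<theta> (z, w)) - \<theta>
      = - \<mu> * \<theta> / (S + \<mu>) + (\<Sum>t=1..T. \<sigma> * x t / (S + \<mu>) * w t)" for w
  proof -
    have "(\<Sum>t=1..T. x t * (x t * \<theta> + \<sigma> * w t)) = S * \<theta> + (\<Sum>t=1..T. \<sigma> * x t * w t)"
      by (simp add: S_def design_energy_def x_def distrib_left sum.distrib sum_distrib_left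
          power2_eq_square ac_simps)
    then have "ridge_estimator T \<mu> (sample T r \<sigma> \<theta> (z, w)) = (S * \<theta> + (\<Sum>t=1..T. \<sigma> * x t * w t)) / (S + \<mu>)"
      by (simp add: ridge_estimator_def sample_def response_def S_def design_energy_def x_def)
    also have "\<dots> - \<theta> = (- \<mu> * \<theta> + (\<Sum>t=1..T. \<sigma> * x t * w t)) / (S + \<mu>)"
      using pos by (simp add: field_simps)
    finally show ?thesis
      by (simp add: add_divide_distrib diff_divide_distrib sum_divide_distrib)
  qed
  have "(- \<mu> * \<theta> / (S + \<mu>))\<^sup>2 + (\<Sum>t=1..T. (\<sigma> * x t / (S + \<mu>))\<^sup>2)
      = (\<mu>\<^sup>2 * \<theta>\<^sup>2 + \<sigma>\<^sup>2 * S) / (S + \<mu>)\<^sup>2"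
    by (simp add: S_def design_energy_def x_def power_divide power_mult_distrib
        sum_divide_distrib[symmetric] sum_distrib_left[symmetric] add_divide_distrib)
  also have "\<dots> \<le> (\<mu>\<^sup>2 * \<rho>\<^sup>2 + \<sigma>\<^sup>2 * S) / (S + \<mu>)\<^sup>2"
    using \<theta> \<rho> by (intro divide_right_mono add_right_mono mult_left_mono) (auto simp: abs_le_square_iff[symmetric])
  also have "\<mu>\<^sup>2 * \<rho>\<^sup>2 = \<sigma>\<^sup>2 * \<mu>"
    using \<rho> by (simp add: \<mu>_def power2_eq_square)
  also have "(\<sigma>\<^sup>2 * \<mu> + \<sigma>\<^sup>2 * S) / (S + \<mu>)\<^sup>2 = \<sigma>\<^sup>2 * (S + \<mu>) / ((S + \<mu>) * (S + \<mu>))"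
    by (simp add: power2_eq_square distrib_left add.commute)
  also have "\<dots> = \<sigma>\<^sup>2 / (S + \<mu>)"
    using pos by simp
  also have "\<dots> = posterior_variance \<rho> \<sigma> S"
  proof -
    have "1 / \<rho>\<^sup>2 + S / \<sigma>\<^sup>2 = (S + \<mu>) / \<sigma>\<^sup>2"
      using \<sigma> by (simp add: \<mu>_def add_divide_distrib)
    then show ?thesis by (simp add: posterior_variance_def)
  qed
  finally have "(- \<mu> * \<theta> / (S + \<mu>))\<^sup>2 + (\<Sum>t=1..T. (\<sigma> * x t / (S + \<mu>))\<^sup>2) \<le> posterior_variance \<rho> \<sigma> S" .
  then show ?thesis
    unfolding \<mu>_def[symmetric] error S_def[symmetric]
    by (subst nn_integral_gaussian_affine_square) (auto intro: ennreal_leI)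
qed

lemma minimax_risk_le_Phi:
  assumes \<rho>: "0 < \<rho>" and \<sigma>: "0 < \<sigma>"
  shows "minimax_risk T r \<rho> \<sigma> \<le> ennreal (Phi T r \<rho> \<sigma>)"
proof -
  let ?\<delta> = "ridge_estimator T (\<sigma>\<^sup>2 / \<rho>\<^sup>2)"
  have "mean_squared_error T r \<sigma> ?\<delta> \<theta> \<le> ennreal (Phi T r \<rho> \<sigma>)" if "\<bar>\<theta>\<bar> \<le> \<rho>" for \<theta>
    unfolding mean_squared_error_iterated[OF measurable_ridge_estimator]
      nn_integral_posterior_variance[OF assms, symmetric]
    by (intro nn_integral_mono ridge_conditional_risk assms that)
  then show ?thesis
    unfolding minimax_risk_def
    by (intro INF_lower2[OF measurable_ridge_estimator] SUP_least) auto
qed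

section \<open>Lower bound by a uniform prior\<close>

text \<open>
  A change of the parameter is the same as a change of the noise in the direction of the covariates;
  this is what makes the Cameron-Martin formula applicable.
\<close>
lemma sample_shift:
  assumes "\<sigma> \<noteq> 0"
  shows "sample T r \<sigma> (\<theta> + h) (z, w)
    = sample T r \<sigma> \<theta> (z, \<lambda>t\<in>{1..T}. w t + covariate r z t * h / \<sigma>)"
  using assms by (auto simp: sample_def response_def fun_eq_iff field_simps)

text \<open>
  Given the design, the estimator is a function of the noise alone. The separation $\sqrt V$ is the
  largest, up to a constant, at which the two parameters remain statistically indistinguishable and
  lie at most $\rho$ apart.
\<close>
lemma conditional_two_point_lower_bound:
  fixes r z :: "nat \<Rightarrow> real"
  assumes \<rho>: "0 < \<rho>" and \<sigma>: "0 < \<sigma>"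
    and [measurable]: "\<delta> \<in> borel_measurable (sample_space T)"
    and z: "z \<in> space (gaussian_on {1..T})"
  defines "V \<equiv> posterior_variance \<rho> \<sigma> (design_energy T r z)"
  shows "ennreal (exp (-1) * V / 4)
      \<le> (\<integral>\<^sup>+w. ennreal ((\<delta> (sample T r \<sigma> \<theta> (z, w)) - \<theta>)\<^sup>2) \<partial>gaussian_on {1..T})
        + (\<integral>\<^sup>+w. ennreal ((\<delta> (sample T r \<sigma> (\<theta> + sqrt V) (z, w)) - (\<theta> + sqrt V))\<^sup>2)
            \<partial>gaussian_on {1..T})"
proof -
  define h where "h = sqrt V"
  have V: "0 < V" "design_energy T r z * V \<le> \<sigma>\<^sup>2"
    unfolding V_def using posterior_variance_bounds(1,3)[OF \<rho> \<sigma> design_energy_nonneg] by auto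
  then have h: "h\<^sup>2 = V" by (simp add: h_def)
  have "(\<Sum>t\<in>{1..T}. (covariate r z t * h / \<sigma>)\<^sup>2) = design_energy T r z * V / \<sigma>\<^sup>2"
    by (simp add: design_energy_def power_divide power_mult_distrib h
        sum_divide_distrib sum_distrib_right)
  also have "\<dots> \<le> 1" using V \<sigma> by simp
  finally have a: "(\<Sum>t\<in>{1..T}. (covariate r z t * h / \<sigma>)\<^sup>2) \<le> 1" .
  have "(\<lambda>w. (\<theta>, (z, w))) \<in> gaussian_on {1..T}
      \<rightarrow>\<^sub>M borel \<Otimes>\<^sub>M (gaussian_on {1..T} \<Otimes>\<^sub>M gaussian_on {1..T})"
    using z by measurable
  from measurable_compose[OF this measurable_sample]
  have "(\<lambda>w. sample T r \<sigma> \<theta> (z, w)) \<in> gaussian_on {1..T} \<rightarrow>\<^sub>M sample_space T"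
    by simp
  then have g: "(\<lambda>w. \<delta> (sample T r \<sigma> \<theta> (z, w))) \<in> borel_measurable (gaussian_on {1..T})"
    by measurable
  have "\<sigma> \<noteq> 0" using \<sigma> by simp
  from two_point_gaussian_lower_bound[OF finite_atLeastAtMost a g, of h \<theta>] show ?thesis
    unfolding h_def[symmetric] sample_shift[OF \<open>\<sigma> \<noteq> 0\<close>] h .
qed

text \<open>
  The mean risk over the uniform prior is at most the maximal risk. In the average the integrals over
  parameter and design are exchanged, which allows a separation that depends on the design. The
  constant $1/(16e)$ is the $1/(4e)$ of the two-point bound, divided by 2 for pairing two parameters
  and by 2 because the pairs are guaranteed to fill only half of the prior interval.
\<close>
lemma Phi_le_sup_risk:
  assumes \<rho>: "0 < \<rho>" and \<sigma>: "0 < \<sigma>"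
    and \<delta> [measurable]: "\<delta> \<in> borel_measurable (sample_space T)"
  shows "ennreal (exp (-1) / 16 * Phi T r \<rho> \<sigma>)
      \<le> (SUP \<theta>\<in>{\<theta>. \<bar>\<theta>\<bar> \<le> \<rho>}. mean_squared_error T r \<sigma> \<delta> \<theta>)"
proof -
  let ?G = "gaussian_on {1..T}"
  interpret G: prob_space ?G by (rule prob_space_gaussian_on)
  interpret P: pair_sigma_finite lborel ?G ..
  define R where "R = (SUP \<theta>\<in>{\<theta>. \<bar>\<theta>\<bar> \<le> \<rho>}. mean_squared_error T r \<sigma> \<delta> \<theta>)"
  define V where "V z = posterior_variance \<rho> \<sigma> (design_energy T r z)" for z
  define F where "F \<theta> z = (\<integral>\<^sup>+w. ennreal ((\<delta> (sample T r \<sigma> \<theta> (z, w)) - \<theta>)\<^sup>2) \<partial>?G)" for \<theta> z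
  have V: "0 < V z" "V z \<le> \<rho>\<^sup>2" for z
    unfolding V_def using posterior_variance_bounds(1,2)[OF \<rho> \<sigma> design_energy_nonneg] by auto
  have V_meas [measurable]: "V \<in> borel_measurable ?G"
    unfolding V_def[abs_def] posterior_variance_def by measurable
  have F_meas [measurable]: "case_prod F \<in> borel_measurable (borel \<Otimes>\<^sub>M ?G)"
  proof -
    have "(\<lambda>p. (fst (fst p), (snd (fst p), snd p))) \<in> (borel \<Otimes>\<^sub>M ?G) \<Otimes>\<^sub>M ?G \<rightarrow>\<^sub>M borel \<Otimes>\<^sub>M (?G \<Otimes>\<^sub>M ?G)"
      by measurable
    from measurable_compose[OF measurable_compose[OF this measurable_sample] \<delta>]
    have [measurable]: "(\<lambda>p. \<delta> (sample T r \<sigma> (fst (fst p)) (snd (fst p), snd p)))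
        \<in> borel_measurable ((borel \<Otimes>\<^sub>M ?G) \<Otimes>\<^sub>M ?G)"
      by simp
    have "(\<lambda>p. ennreal ((\<delta> (sample T r \<sigma> (fst (fst p)) (snd (fst p), snd p)) - fst (fst p))\<^sup>2))
        \<in> borel_measurable ((borel \<Otimes>\<^sub>M ?G) \<Otimes>\<^sub>M ?G)"
      by measurable
    from G.borel_measurable_nn_integral_fst[OF this] show ?thesis
      by (simp add: F_def case_prod_beta')
  qed
  have cond: "ennreal (\<rho> * (exp (-1) * V z / 4)) \<le> 2 * (\<integral>\<^sup>+\<theta>\<in>{-\<rho>..\<rho>}. F \<theta> z \<partial>lborel)"
    if z: "z \<in> space ?G" for z
  proof (rule nn_integral_pairing_lower_bound)
    show "(\<lambda>\<theta>. F \<theta> z) \<in> borel_measurable borel"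
      using measurable_compose[OF measurable_Pair2'[OF z] F_meas] by simp
    show "0 \<le> sqrt (V z)" "0 \<le> exp (-1) * V z / 4"
      using V[of z] by auto
    show "sqrt (V z) \<le> \<rho>"
      using V[of z] \<rho> by (intro real_le_lsqrt) auto
    show "ennreal (exp (-1) * V z / 4) \<le> F \<theta> z + F (\<theta> + sqrt (V z)) z" for \<theta>
      unfolding F_def V_def by (rule conditional_two_point_lower_bound[OF \<rho> \<sigma> \<delta> z])
  qed
  have "ennreal (4 * \<rho>) * ennreal (exp (-1) / 16 * Phi T r \<rho> \<sigma>)
      = ennreal (\<rho> * exp (-1) / 4) * (\<integral>\<^sup>+z. ennreal (V z) \<partial>?G)"
    unfolding V_def nn_integral_posterior_variance[OF \<rho> \<sigma>] using \<rho>
    by (simp add: ennreal_mult'[symmetric] mult.assoc)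
  also have "\<dots> = (\<integral>\<^sup>+z. ennreal (\<rho> * (exp (-1) * V z / 4)) \<partial>?G)"
    using \<rho> by (subst nn_integral_cmult[symmetric], measurable)
      (auto intro!: nn_integral_cong simp: ennreal_mult'[symmetric] mult.assoc)
  also have "\<dots> \<le> (\<integral>\<^sup>+z. 2 * (\<integral>\<^sup>+\<theta>\<in>{-\<rho>..\<rho>}. F \<theta> z \<partial>lborel) \<partial>?G)"
    by (intro nn_integral_mono cond)
  also have "\<dots> = 2 * (\<integral>\<^sup>+z. (\<integral>\<^sup>+\<theta>\<in>{-\<rho>..\<rho>}. F \<theta> z \<partial>lborel) \<partial>?G)"
    by (intro nn_integral_cmult) measurable
  also have "(\<integral>\<^sup>+z. (\<integral>\<^sup>+\<theta>\<in>{-\<rho>..\<rho>}. F \<theta> z \<partial>lborel) \<partial>?G)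
      = (\<integral>\<^sup>+\<theta>. (\<integral>\<^sup>+z. F \<theta> z * indicator {-\<rho>..\<rho>} \<theta> \<partial>?G) \<partial>lborel)"
    by (intro P.Fubini') measurable
  also have "\<dots> \<le> (\<integral>\<^sup>+\<theta>. R * indicator {-\<rho>..\<rho>} \<theta> \<partial>lborel)"
  proof (intro nn_integral_mono)
    fix \<theta>
    have "(\<integral>\<^sup>+z. F \<theta> z \<partial>?G) \<le> R" if "\<theta> \<in> {-\<rho>..\<rho>}"
      unfolding R_def F_def mean_squared_error_iterated[OF \<delta>, symmetric]
      using that by (intro SUP_upper) auto
    then show "(\<integral>\<^sup>+z. F \<theta> z * indicator {-\<rho>..\<rho>} \<theta> \<partial>?G) \<le> R * indicator {-\<rho>..\<rho>} \<theta>"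
      by (auto split: split_indicator)
  qed
  also have "\<dots> = R * ennreal (2 * \<rho>)"
    using \<rho> by (subst nn_integral_cmult_indicator) auto
  also have "2 * (R * ennreal (2 * \<rho>)) = ennreal (4 * \<rho>) * R"
  proof -
    have "ennreal (4 * \<rho>) = ennreal 2 * ennreal (2 * \<rho>)"
      using \<rho> by (subst ennreal_mult[symmetric]) auto
    then show ?thesis by (simp only: ennreal_numeral ac_simps)
  qed
  finally have "ennreal (4 * \<rho>) * ennreal (exp (-1) / 16 * Phi T r \<rho> \<sigma>) \<le> ennreal (4 * \<rho>) * R"
    by (simp add: mult_left_mono)
  then show ?thesis
    unfolding R_def[symmetric] using \<rho> by (simp add: ennreal_mult_le_mult_iff)
qed

theorem corollary5:
  shows "\<exists>c C :: real. 0 < c \<and> c \<le> C \<and>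
    (\<forall>(T::nat) (r :: nat \<Rightarrow> real) (\<rho>::real) (\<sigma>::real).
       1 \<le> T \<longrightarrow> (\<forall>t\<in>{1..T}. 0 \<le> r t \<and> r t \<le> 1) \<longrightarrow> 0 < \<rho> \<longrightarrow> 0 < \<sigma> \<longrightarrow>
       ennreal (c * Phi T r \<rho> \<sigma>) \<le> minimax_risk T r \<rho> \<sigma> \<and>
       minimax_risk T r \<rho> \<sigma> \<le> ennreal (C * Phi T r \<rho> \<sigma>))"
proof (intro exI conjI allI impI)
  show "0 < exp (-1) / (16::real)" by simp
  show "exp (-1) / 16 \<le> (1::real)"
    using exp_le_one_iff[of "-1::real"] by linarith
next
  fix T r and \<rho> \<sigma> :: real assume \<rho>: "0 < \<rho>" and \<sigma>: "0 < \<sigma>"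
  show "ennreal (exp (-1) / 16 * Phi T r \<rho> \<sigma>) \<le> minimax_risk T r \<rho> \<sigma>"
    unfolding minimax_risk_def by (intro INF_greatest Phi_le_sup_risk[OF \<rho> \<sigma>])
  show "minimax_risk T r \<rho> \<sigma> \<le> ennreal (1 * Phi T r \<rho> \<sigma>)"
    using minimax_risk_le_Phi[OF \<rho> \<sigma>] by simp
qed

end
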